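(* Let $r,n\ge 1$ be integers with $r$ even. Then $$\sum_{\pi\in G(r,n)}(-1)^{\mathrm{fmaj}(\pi)}q^{\mathrm{fmaf}(\pi)} =\sum_{\pi\in G(r,n)}(-1)^{\mathrm{fmaf}(\pi)}q^{\mathrm{fmaj}(\pi)}=\prod_{k=1}^n[rk]_{-q}.$$
   Context: For an integer $m\ge 0$ and any quantity $p$, $[m]_p:=1+p+\cdots+p^{m-1}$. $G(r,n)=C_r\wr\mathfrak S_n$ is the group of $r$-colored permutations; an element is a word $\pi=\pi_1\cdots\pi_n=\sigma_1^{[z_1]}\cdots\sigma_n^{[z_n]}$ with $\sigma\in\mathfrak S_n$ and colors $z_i\in\{0,1,\dots,r-1\}$, with $i^{[0]}=i$. The colored letters are ordered linearly by $$(1^{[r-1]}<\cdots<n^{[r-1]})<\cdots<(1^{[1]}<\cdots<n^{[1]})<(1<\cdots<n),$$ and with respect to this order $\mathrm{maj}(\pi):=\sum_{1\le i\le n-1,\ \pi_i>\pi_{i+1}} i$. The flag major index is $\mathrm{fmaj}(\pi):=r\cdot\mathrm{maj}(\pi)+\sum_{i=1}^n z_i$. The flag maf index is $\mathrm{fmaf}(\pi):=r\sum_{j=1}^k(i_j-j)+\mathrm{fmaj}(\tilde\pi)$, where $\{i_1<i_2<\cdots<i_k\}=\mathrm{Fix}(\pi):=\{i:\pi_i=i\}$ (i.e. $\sigma_i=i$ and $z_i=0$), and $\tilde\pi\in G(r,n-k)$ is obtained from $\pi$ by deleting the fixed terms $\pi_{i_1},\dots,\pi_{i_k}$ and renumbering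 the absolute values of the remaining terms by $1,\dots,n-k$ preserving their relative order, keeping their colors (if $k=n$, $\tilde\pi$ is empty and $\mathrm{fmaj}(\tilde\pi)=0$). *)

theory Defs
  imports "HOL-Combinatorics.Multiset_Permutations"
begin

text \<open>
  A colored letter is a pair (absolute value, color), so that \<open>(i, z)\<close> stands for
  \<open>i\<close> with color \<open>z\<close>; an element of \<open>G(r,n)\<close> is its word of colored letters.
  Positions are counted from 1 as on paper: the letter at position \<open>i\<close> is \<open>w ! (i - 1)\<close>.
\<close>

type_synonym colored_word = "(nat \<times> nat) list"

definition colored_perms :: "nat \<Rightarrow> nat \<Rightarrow> colored_word set" where
  "colored_perms r n =
     {w. map fst w \<in> permutations_of_set {1..n} \<and> (\<forall>x\<in>set w. snd x < r)}"

text \<open>Letters of larger color are smaller; within one color, absolute values decide.\<close>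

definition letter_less :: "nat \<times> nat \<Rightarrow> nat \<times> nat \<Rightarrow> bool" where
  "letter_less x y \<longleftrightarrow> snd x > snd y \<or> (snd x = snd y \<and> fst x < fst y)"

definition maj :: "colored_word \<Rightarrow> nat" where
  "maj w = \<Sum>{i \<in> {1..<length w}. letter_less (w ! i) (w ! (i - 1))}"

definition fmaj :: "nat \<Rightarrow> colored_word \<Rightarrow> nat" where
  "fmaj r w = r * maj w + sum_list (map snd w)"

definition Fix :: "colored_word \<Rightarrow> nat set" where
  "Fix w = {i \<in> {1..length w}. w ! (i - 1) = (i, 0)}"

text \<open>Each absolute value is replaced by its rank among those occurring in the word.\<close>

definition renumber :: "colored_word \<Rightarrow> colored_word" where
  "renumber w = map (\<lambda>(a, z). (card {b \<in> fst ` set w. b \<le> a}, z)) w"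

text \<open>\<^const>\<open>nths\<close> counts positions from 0.\<close>

definition delete_fixed :: "colored_word \<Rightarrow> colored_word" where
  "delete_fixed w = renumber (nths w {i. Suc i \<notin> Fix w})"

text \<open>
  With \<open>i\<^sub>1 < \<dots> < i\<^sub>k\<close> the sorted elements of \<^term>\<open>Fix w\<close>, the number \<open>i\<^sub>j\<close> is the
  list entry \<open>j - 1\<close>. Since all elements of \<^term>\<open>Fix w\<close> are positive, \<open>i\<^sub>j \<ge> j\<close>
  and the subtraction on natural numbers never truncates.
\<close>

definition fmaf :: "nat \<Rightarrow> colored_word \<Rightarrow> nat" where
  "fmaf r w =
     r * (\<Sum>j = 1..card (Fix w). sorted_list_of_set (Fix w) ! (j - 1) - j)
     + fmaj r (delete_fixed w)"

definition bracket :: "nat \<Rightarrow> 'a::comm_ring_1 \<Rightarrow> 'a" where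
  "bracket m p = (\<Sum>i<m. p ^ i)"

lemma finite_colored_perms: "finite (colored_perms r n)"
proof (rule finite_subset)
  show "colored_perms r n \<subseteq> {w. set w \<subseteq> {1..n} \<times> {..<r} \<and> length w = n}"
  proof
    fix w assume w: "w \<in> colored_perms r n"
    then have p: "map fst w \<in> permutations_of_set {1..n}" and c: "\<forall>x\<in>set w. snd x < r"
      by (auto simp: colored_perms_def)
    have "fst ` set w = {1..n}"
      using permutations_of_setD(1)[OF p] by simp
    moreover have "length w = n"
      using length_finite_permutations_of_set[OF p] by simp
    ultimately show "w \<in> {w. set w \<subseteq> {1..n} \<times> {..<r} \<and> length w = n}"
      using c by (force simp: mem_Times_iff)
  qed
  show "finite {w. set w \<subseteq> {1..n} \<times> {..<r} \<and> length w = n}"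
    by (rule finite_lists_length_eq) simp
qed

end

theory Submission
  imports Defs
begin

text \<open>
  Since \<open>r\<close> is even and fixed letters have color \<open>0\<close>, both \<^const>\<open>fmaj\<close> and \<^const>\<open>fmaf\<close> have the
  parity of the sum of the colors. Hence each signed summand is a power of \<open>- q\<close>, and the claim
  reduces to two facts about unsigned sums: \<^const>\<open>fmaj\<close> and \<^const>\<open>fmaf\<close> are equidistributed
  (\<open>fmaf_fmaj_equidistributed\<close>), and the generating function of \<^const>\<open>fmaj\<close> is the product of the
  brackets (\<open>sum_fmaj\<close>).

  For the equidistribution, a colored permutation is encoded by its set \<open>S\<close> of fixed positions and
  the derangement \<open>v\<close> that remains after deleting them. With \<open>v\<close> and the number \<open>k\<close> of fixed
  positions held fast, \<^const>\<open>fmaf\<close> is by definition \<open>fmaj v\<close> plus \<open>r\<close> times a statistic of \<open>S\<close> whose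
  distribution is a Gaussian binomial coefficient. For \<^const>\<open>fmaj\<close> the same follows from an
  observation of Wachs: fixed letters may all be replaced by a single neutral letter \<open>0\<close>, letters
  that are uncolored and exceed their position by letters above \<open>0\<close>, and all other letters by
  letters below \<open>0\<close>, without changing any descent (\<open>letter_less_iff_shuffle_letter\<close>). Thus the
  colored permutations belonging to \<open>v\<close> become the shuffles of one word with \<open>k\<close> zeros, and the
  distribution of the major index over these shuffles is the same Gaussian binomial coefficient,
  shifted by \<open>maj v\<close> (\<open>sum_shuffle_maj\<close>).

  The generating function of \<^const>\<open>fmaj\<close> is computed by induction on the length, refined by the last
  letter (\<open>sum_fmaj_append_letter\<close>): the possible last letters contribute consecutive exponents,
  whose sum is one more bracket.
\<close>

section \<open>Gaussian binomial coefficients and sets of positions\<close>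

text \<open>
  The Gaussian binomial coefficient, given by its Pascal recursion so that it makes sense for
  every element \<open>q\<close> of a commutative ring, without division.
\<close>

fun qbinom :: "'a::comm_ring_1 \<Rightarrow> nat \<Rightarrow> nat \<Rightarrow> 'a" where
  "qbinom q n 0 = 1"
| "qbinom q 0 (Suc k) = 0"
| "qbinom q (Suc n) (Suc k) = qbinom q n k + q ^ Suc k * qbinom q n (Suc k)"

lemma qbinom_eq_0: "n < k \<Longrightarrow> qbinom q n k = 0"
  by (induction q n k rule: qbinom.induct) auto

text \<open>
  The second Pascal recursion. The shuffle sums below need both, according to how the last letters
  of a word compare with each other and with the neutral letter.
\<close>

lemma qbinom_Suc_Suc':
  "k \<le> n \<Longrightarrow> qbinom q (Suc n) (Suc k) = qbinom q n (Suc k) + q ^ (n - k) * qbinom q n k"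
proof (induction n arbitrary: k)
  case (Suc n)
  show ?case
  proof (cases k)
    case 0
    have "qbinom q (Suc n) 1 = qbinom q n 1 + q ^ n"
      using Suc.IH[of 0] by simp
    then show ?thesis
      using 0 by (simp add: algebra_simps)
  next
    case (Suc l)
    have l: "l \<le> n" using Suc.prems Suc by simp
    have 1: "qbinom q (Suc n) (Suc l) = qbinom q n (Suc l) + q ^ (n - l) * qbinom q n l"
      by (rule Suc.IH[OF l])
    show ?thesis
    proof (cases "k = Suc n")
      case True
      then show ?thesis by (simp add: qbinom_eq_0)
    next
      case False
      then have k: "k \<le> n" using Suc.prems by simp
      have 2: "qbinom q (Suc n) (Suc k) = qbinom q n (Suc k) + q ^ (n - k) * qbinom q n k"
        by (rule Suc.IH[OF k])
      have e: "q ^ Suc k * q ^ (n - k) = q ^ (n - l) * q ^ k"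
        using k Suc by (simp add: Suc_diff_Suc flip: power_add power_Suc)
      have "qbinom q (Suc (Suc n)) (Suc k)
          = qbinom q n k + q ^ (n - l) * qbinom q n l
            + q ^ Suc k * (qbinom q n (Suc k) + q ^ (n - k) * qbinom q n k)"
        unfolding qbinom.simps(3)[of q "Suc n" k] 2 using 1 Suc by simp
      also have "\<dots> = (qbinom q n k + q ^ Suc k * qbinom q n (Suc k))
            + q ^ (n - l) * (qbinom q n l + q ^ k * qbinom q n k)"
        using e by (simp add: algebra_simps)
      also have "\<dots> = qbinom q (Suc n) (Suc k) + q ^ (Suc n - k) * qbinom q (Suc n) k"
        using Suc by simp
      finally show ?thesis .
    qed
  qed
qed simp

definition ksubsets :: "nat \<Rightarrow> nat \<Rightarrow> nat set set" where
  "ksubsets n k = {S. S \<subseteq> {1..n} \<and> card S = k}"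

lemma finite_ksubsets: "finite (ksubsets n k)"
  unfolding ksubsets_def by (rule finite_subset[of _ "Pow {1..n}"]) auto

lemma ksubsets_finite: "S \<in> ksubsets n k \<Longrightarrow> finite S"
  unfolding ksubsets_def by (metis (lifting) CollectD finite_atLeastAtMost finite_subset)

lemma ksubsets_0: "ksubsets n 0 = {{}}"
proof -
  have "S = {}" if "S \<in> ksubsets n 0" for S
    using ksubsets_finite[OF that] that by (simp add: ksubsets_def)
  moreover have "{} \<in> ksubsets n 0" by (simp add: ksubsets_def)
  ultimately show ?thesis by blast
qed

lemma ksubsets_le: "S \<in> ksubsets n k \<Longrightarrow> k \<le> n"
  unfolding ksubsets_def using card_mono[of "{1..n}" S] by simp

lemma ksubsets_eq_empty: "n < k \<Longrightarrow> ksubsets n k = {}"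
  using ksubsets_le by fastforce

lemma sum_ksubsets_Suc:
  "sum g (ksubsets (Suc n) (Suc k))
     = sum g (ksubsets n (Suc k)) + (\<Sum>S\<in>ksubsets n k. g (insert (Suc n) S))"
proof -
  have fin: "finite S" if "S \<subseteq> {1..n}" for S
    using that finite_subset by blast
  have split: "ksubsets (Suc n) (Suc k) = ksubsets n (Suc k) \<union> insert (Suc n) ` ksubsets n k"
  proof (intro equalityI subsetI)
    fix S assume S: "S \<in> ksubsets (Suc n) (Suc k)"
    show "S \<in> ksubsets n (Suc k) \<union> insert (Suc n) ` ksubsets n k"
    proof (cases "Suc n \<in> S")
      case True
      have "S - {Suc n} \<in> ksubsets n k"
        using S True by (auto simp: ksubsets_def le_Suc_eq)
      then show ?thesis using True by (metis UnI2 imageI insert_Diff)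
    next
      case False
      then show ?thesis using S by (fastforce simp: ksubsets_def le_Suc_eq)
    qed
  next
    fix S assume "S \<in> ksubsets n (Suc k) \<union> insert (Suc n) ` ksubsets n k"
    then show "S \<in> ksubsets (Suc n) (Suc k)"
    proof
      assume "S \<in> insert (Suc n) ` ksubsets n k"
      then obtain T where T: "S = insert (Suc n) T" "T \<subseteq> {1..n}" "card T = k"
        by (auto simp: ksubsets_def)
      moreover have "Suc n \<notin> T" using T(2) by auto
      ultimately show ?thesis using fin[OF T(2)] by (auto simp: ksubsets_def)
    qed (auto simp: ksubsets_def)
  qed
  have inj: "inj_on (insert (Suc n)) (ksubsets n k)"
  proof (rule inj_onI)
    fix S T assume "S \<in> ksubsets n k" "T \<in> ksubsets n k" "insert (Suc n) S = insert (Suc n) T"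
    moreover from this have "Suc n \<notin> S" "Suc n \<notin> T" by (auto simp: ksubsets_def)
    ultimately show "S = T" by (simp add: insert_ident)
  qed
  have disj: "ksubsets n (Suc k) \<inter> insert (Suc n) ` ksubsets n k = {}"
    by (auto simp: ksubsets_def)
  show ?thesis
    unfolding split by (simp add: sum.union_disjoint disj finite_ksubsets sum.reindex inj)
qed

lemma card_Diff_ksubset: "S \<in> ksubsets n k \<Longrightarrow> card ({1..n} - S) = n - k"
  using ksubsets_finite[of S n k] by (simp add: ksubsets_def card_Diff_subset)

lemma ksubset_Suc_Diff:
  assumes "S \<in> ksubsets n k"
  shows "{1..Suc n} - insert (Suc n) S = {1..n} - S"
    and "{1..Suc n} - S = insert (Suc n) ({1..n} - S)"
  using assms by (auto simp: ksubsets_def)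

text \<open>
  The exponent is the one by which \<^const>\<open>fmaf\<close> records the fixed points, because
  \<open>i\<^sub>j - j\<close> counts the elements of \<open>{1..i\<^sub>j}\<close> outside the set. Putting \<open>n + 1\<close> into a set with
  \<open>k\<close> elements adds \<open>n - k\<close>, which is the second Pascal recursion.
\<close>

lemma qbinom_eq_sum_ksubsets:
  "(\<Sum>S\<in>ksubsets n k. q ^ (\<Sum>i\<in>S. card ({1..i} - S))) = qbinom q n k"
proof (induction n arbitrary: k)
  case 0
  show ?case by (cases k) (simp_all add: ksubsets_0 ksubsets_eq_empty)
next
  case (Suc n)
  show ?case
  proof (cases k)
    case 0
    then show ?thesis by (simp add: ksubsets_0)
  next
    case (Suc l)
    have step: "(\<Sum>i\<in>insert (Suc n) S. card ({1..i} - insert (Suc n) S))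
        = n - l + (\<Sum>i\<in>S. card ({1..i} - S))" if S: "S \<in> ksubsets n l" for S
    proof -
      have "{1..i} - insert (Suc n) S = {1..i} - S" if "i \<in> S" for i
        using S that by (auto simp: ksubsets_def)
      moreover have "finite S" "Suc n \<notin> S"
        using S ksubsets_finite[OF S] by (auto simp: ksubsets_def)
      ultimately show ?thesis
        using card_Diff_ksubset[OF S] ksubset_Suc_Diff(1)[OF S] by simp
    qed
    have "(\<Sum>S\<in>ksubsets (Suc n) k. q ^ (\<Sum>i\<in>S. card ({1..i} - S)))
        = qbinom q n (Suc l) + (\<Sum>S\<in>ksubsets n l. q ^ (n - l) * q ^ (\<Sum>i\<in>S. card ({1..i} - S)))"
      unfolding Suc sum_ksubsets_Suc Suc.IH using step
      by (auto simp: power_add intro!: sum.cong)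
    also have "\<dots> = qbinom q n (Suc l) + q ^ (n - l) * qbinom q n l"
      by (simp only: sum_distrib_left[symmetric] Suc.IH)
    also have "\<dots> = qbinom q (Suc n) k"
      using Suc by (cases "l \<le> n") (simp_all add: qbinom_Suc_Suc' qbinom_eq_0 del: qbinom.simps(3))
    finally show ?thesis .
  qed
qed

section \<open>Shuffling a word with a neutral letter\<close>

text \<open>
  Here \<open>K 1, K 2, \<dots>\<close> is a word of nonzero integers, and \<open>0\<close> is the neutral letter. The shuffle
  determined by \<open>S\<close> has \<open>0\<close> at the positions in \<open>S\<close> and the letters of \<open>K\<close>, in order, at the other
  positions. Letting \<open>K\<close> be infinite makes prefixes of a shuffle shuffles again, so that inductions
  on the length need no truncated words.
\<close>

definition shuffle_letter :: "(nat \<Rightarrow> int) \<Rightarrow> nat set \<Rightarrow> nat \<Rightarrow> int" where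
  "shuffle_letter K S i = (if i \<in> S then 0 else K (card ({1..i} - S)))"

definition shuffle_maj :: "(nat \<Rightarrow> int) \<Rightarrow> nat \<Rightarrow> nat set \<Rightarrow> nat" where
  "shuffle_maj K n S = \<Sum>{i \<in> {1..<n}. shuffle_letter K S (Suc i) < shuffle_letter K S i}"

lemma shuffle_maj_Suc:
  "shuffle_maj K (Suc n) S = shuffle_maj K n S
     + (if shuffle_letter K S (Suc n) < shuffle_letter K S n then n else 0)"
proof -
  let ?D = "{i \<in> {1..<n}. shuffle_letter K S (Suc i) < shuffle_letter K S i}"
  have "{i \<in> {1..<Suc n}. shuffle_letter K S (Suc i) < shuffle_letter K S i}
      = (if n \<ge> 1 \<and> shuffle_letter K S (Suc n) < shuffle_letter K S n then insert n ?D else ?D)"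
    by (auto simp: less_Suc_eq)
  then show ?thesis unfolding shuffle_maj_def by auto
qed

lemma shuffle_letter_insert:
  "i \<le> n \<Longrightarrow> shuffle_letter K (insert (Suc n) S) i = shuffle_letter K S i"
proof -
  assume "i \<le> n"
  then have "{1..i} - insert (Suc n) S = {1..i} - S" "i \<noteq> Suc n" by auto
  then show ?thesis by (simp add: shuffle_letter_def)
qed

lemma shuffle_maj_insert: "shuffle_maj K n (insert (Suc n) S) = shuffle_maj K n S"
proof -
  have "{i \<in> {1..<n}. shuffle_letter K (insert (Suc n) S) (Suc i) < shuffle_letter K (insert (Suc n) S) i}
      = {i \<in> {1..<n}. shuffle_letter K S (Suc i) < shuffle_letter K S i}"
    by (auto simp: shuffle_letter_insert)
  then show ?thesis by (simp add: shuffle_maj_def)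
qed

lemma shuffle_maj_Suc_insert:
  "shuffle_maj K (Suc n) (insert (Suc n) S)
     = shuffle_maj K n S + (if 0 < shuffle_letter K S n then n else 0)"
  by (simp add: shuffle_maj_Suc shuffle_maj_insert shuffle_letter_insert)
     (simp add: shuffle_letter_def)

lemma shuffle_maj_empty_Suc:
  "shuffle_maj K (Suc m) {} = shuffle_maj K m {} + (if K (Suc m) < K m then m else 0)"
  by (simp add: shuffle_maj_Suc shuffle_letter_def)

lemma shuffle_letter_last:
  assumes "S \<in> ksubsets n k"
  shows "shuffle_letter K S (Suc n) = K (Suc n - k)"
proof -
  have "Suc n \<notin> S" using assms by (auto simp: ksubsets_def)
  moreover have "k \<le> n" using assms ksubsets_le by blast
  ultimately show ?thesis
    using card_Diff_ksubset[OF assms]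
    by (simp add: shuffle_letter_def ksubset_Suc_Diff[OF assms, unfolded One_nat_def] Suc_diff_le)
qed

text \<open>
  A shuffle of length \<open>n + 1\<close> ends in \<open>0\<close> (first sum) or in a letter of \<open>K\<close> (second sum), and removing
  its last letter leaves a shuffle of length \<open>n\<close> whose last letter decides whether \<open>n\<close> is a descent.
  The two sums therefore satisfy a joint recursion, which the two stated products solve. Which
  sum carries the extra power of \<open>q\<close> depends on whether the last letter used from \<open>K\<close> lies above
  or below \<open>0\<close>.
\<close>

lemma shuffle_sums:
  fixes q :: "'a::comm_ring_1"
  assumes K: "\<And>i. K i \<noteq> 0" and "k \<le> n"
  shows "(\<Sum>S\<in>ksubsets n k. q ^ shuffle_maj K (Suc n) (insert (Suc n) S))
           = q ^ (shuffle_maj K (n - k) {} + (if 0 < K (n - k) then n - k else 0)) * qbinom q n k"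
        (is "?F n k = ?f n k")
    and "(\<Sum>S\<in>ksubsets n k. q ^ shuffle_maj K (Suc n) S)
           = q ^ (shuffle_maj K (Suc n - k) {} + (if 0 < K (Suc n - k) then 0 else k)) * qbinom q n k"
        (is "?N n k = ?g n k")
proof -
  have base: "?F n 0 = ?f n 0" "?N n 0 = ?g n 0" for n
    by (simp_all add: ksubsets_0 shuffle_maj_Suc_insert) (simp_all add: shuffle_letter_def)
  have "?F n k = ?f n k \<and> ?N n k = ?g n k" using \<open>k \<le> n\<close>
  proof (induction n arbitrary: k)
    case 0
    then show ?case using base by simp
  next
    case (Suc n)
    show ?case
    proof (cases k)
      case 0
      then show ?thesis using base by simp
    next
      case k: (Suc l)
      define m where "m = n - l"
      have l: "l \<le> n" and n: "n = m + l" using Suc.prems k by (auto simp: m_def)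
      define M where "M = shuffle_maj K m {}"
      have M': "shuffle_maj K (Suc m) {} = M + (if K (Suc m) < K m then m else 0)"
        by (simp add: M_def shuffle_maj_empty_Suc)
      have F: "?F n l = q ^ (M + (if 0 < K m then m else 0)) * qbinom q n l"
        using Suc.IH[OF l] by (simp add: m_def M_def)
      have N: "?N n (Suc l) = q ^ (M + (if 0 < K m then 0 else Suc l)) * qbinom q n (Suc l)"
      proof (cases "Suc l \<le> n")
        case True
        then show ?thesis using Suc.IH[OF True] by (simp add: m_def M_def)
      next
        case False
        then show ?thesis by (simp add: ksubsets_eq_empty qbinom_eq_0)
      qed
      have last1: "shuffle_letter K S (Suc n) = K m" if "S \<in> ksubsets n (Suc l)" for S
        using shuffle_letter_last[OF that] by (simp add: m_def)
      have last2: "shuffle_letter K S (Suc (Suc n)) = K (Suc m)" if "S \<in> ksubsets (Suc n) (Suc l)" for S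
        using shuffle_letter_last[OF that] l by (simp add: m_def Suc_diff_le)
      have sub1: "S \<in> ksubsets (Suc n) (Suc l)" if "S \<in> ksubsets n (Suc l)" for S
        using that by (auto simp: ksubsets_def)
      have sub2: "insert (Suc n) S \<in> ksubsets (Suc n) (Suc l)" if "S \<in> ksubsets n l" for S
      proof -
        have "Suc n \<notin> S" "finite S" using that ksubsets_finite[OF that] by (auto simp: ksubsets_def)
        then show ?thesis using that by (auto simp: ksubsets_def)
      qed
      have ins: "shuffle_letter K (insert (Suc n) S) (Suc n) = 0" for S
        by (simp add: shuffle_letter_def)
      have FF: "?F (Suc n) (Suc l) = q ^ (if 0 < K m then Suc n else 0) * ?N n (Suc l) + ?F n l"
        unfolding sum_ksubsets_Suc sum_distrib_left
        by (intro arg_cong2[where f = "(+)"] sum.cong refl)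
           (simp_all only: shuffle_maj_Suc_insert[of K "Suc n"] last1 ins power_add
              less_irrefl if_False power_0 mult_1_left mult_1_right mult.commute)
      have NN: "?N (Suc n) (Suc l) = q ^ (if K (Suc m) < K m then Suc n else 0) * ?N n (Suc l)
          + q ^ (if K (Suc m) < 0 then Suc n else 0) * ?F n l"
        unfolding sum_ksubsets_Suc sum_distrib_left
        by (intro arg_cong2[where f = "(+)"] sum.cong refl)
           (simp_all only: shuffle_maj_Suc[of K "Suc n"] last1 last2 sub1 sub2 ins power_add
              mult.commute)
      have p1: "qbinom q (Suc n) (Suc l) = qbinom q n l + q ^ Suc l * qbinom q n (Suc l)"
        by simp
      have p2: "qbinom q (Suc n) (Suc l) = qbinom q n (Suc l) + q ^ m * qbinom q n l"
        unfolding m_def by (rule qbinom_Suc_Suc'[OF l])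
      have "?F (Suc n) (Suc l) = ?f (Suc n) (Suc l)"
        unfolding FF F N diff_Suc_Suc m_def[symmetric] M_def[symmetric] p1
        by (simp add: n power_add algebra_simps)
      moreover have "?N (Suc n) (Suc l) = ?g (Suc n) (Suc l)"
      proof -
        have m': "Suc (Suc n) - Suc l = Suc m" using l by (simp add: m_def)
        \<comment> \<open>The sign patterns of the last two letters of \<open>K\<close>; unequal signs decide their comparison.
            For equal signs, a descent calls for the first Pascal recursion, an ascent for the second.\<close>
        consider (a) "0 < K m" "0 < K (Suc m)" "\<not> K (Suc m) < K m"
          | (b) "0 < K m" "0 < K (Suc m)" "K (Suc m) < K m"
          | (c) "0 < K m" "K (Suc m) < 0" "K (Suc m) < K m"
          | (d) "K m < 0" "0 < K (Suc m)" "\<not> K (Suc m) < K m"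
          | (e) "K m < 0" "K (Suc m) < 0" "\<not> K (Suc m) < K m"
          | (f) "K m < 0" "K (Suc m) < 0" "K (Suc m) < K m"
          using K[of m] K[of "Suc m"] by linarith
        then show ?thesis
        proof cases
          case a
          then show ?thesis unfolding NN F N m' M' p2 by (simp add: n power_add algebra_simps)
        next
          case b
          then show ?thesis unfolding NN F N m' M' p1 by (simp add: n power_add algebra_simps)
        next
          case c
          then show ?thesis unfolding NN F N m' M' p2 by (simp add: n power_add algebra_simps)
        next
          case d
          then show ?thesis unfolding NN F N m' M' p1 by (simp add: n power_add algebra_simps)
        next
          case e
          then show ?thesis unfolding NN F N m' M' p2 by (simp add: n power_add algebra_simps)
        next
          case f
          then show ?thesis unfolding NN F N m' M' p1 by (simp add: n power_add algebra_simps)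
        qed
      qed
      ultimately show ?thesis using k by simp
    qed
  qed
  then show "?F n k = ?f n k" "?N n k = ?g n k" by auto
qed

text \<open>
  The case of the shuffle theorem of Garsia and Gessel in which one of the two words is constant:
  the distribution of the major index over all shuffles depends on \<open>K\<close> only through the major
  index of its first \<open>n - k\<close> letters. Adding the two sums of the preceding lemma
  reproduces one of the two Pascal recursions.
\<close>

theorem sum_shuffle_maj:
  fixes q :: "'a::comm_ring_1"
  assumes K: "\<And>i. K i \<noteq> 0" and "k \<le> n"
  shows "(\<Sum>S\<in>ksubsets n k. q ^ shuffle_maj K n S) = q ^ shuffle_maj K (n - k) {} * qbinom q n k"
proof (cases n)
  case 0
  then show ?thesis using assms by (simp add: ksubsets_0)
next
  case n: (Suc N)
  show ?thesis
  proof (cases k)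
    case 0
    then show ?thesis by (simp add: ksubsets_0)
  next
    case k: (Suc l)
    define m where "m = N - l"
    have l: "l \<le> N" using assms n k by simp
    have F: "(\<Sum>S\<in>ksubsets N l. q ^ shuffle_maj K (Suc N) (insert (Suc N) S))
        = q ^ (shuffle_maj K m {} + (if 0 < K m then m else 0)) * qbinom q N l"
      unfolding m_def by (rule shuffle_sums(1)[OF K l])
    have N: "(\<Sum>S\<in>ksubsets N (Suc l). q ^ shuffle_maj K (Suc N) S)
        = q ^ (shuffle_maj K m {} + (if 0 < K m then 0 else Suc l)) * qbinom q N (Suc l)"
      using shuffle_sums(2)[where k = "Suc l" and n = N and K = K and q = q, OF K]
      by (cases "Suc l \<le> N") (simp_all add: m_def ksubsets_eq_empty qbinom_eq_0)
    have p2: "qbinom q (Suc N) (Suc l) = qbinom q N (Suc l) + q ^ m * qbinom q N l"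
      unfolding m_def by (rule qbinom_Suc_Suc'[OF l])
    have mm: "n - k = m" using n k m_def by simp
    show ?thesis
    proof (cases "0 < K m")
      case True
      then show ?thesis unfolding mm unfolding n k sum_ksubsets_Suc F N p2
        by (simp add: power_add algebra_simps)
    next
      case False
      then show ?thesis unfolding mm unfolding n k sum_ksubsets_Suc F N
        by (simp add: power_add algebra_simps)
    qed
  qed
qed

section \<open>Colored permutations as derangements with inserted fixed letters\<close>

text \<open>Positions start at \<open>1\<close> throughout, so that \<open>1\<close> is kept from being rewritten to \<open>Suc 0\<close>.\<close>

declare One_nat_def [simp del]

definition free_rank :: "nat set \<Rightarrow> nat \<Rightarrow> nat" where
  "free_rank S i = card ({1..i} - S)"

lemma free_rank_mono: "i \<le> j \<Longrightarrow> free_rank S i \<le> free_rank S j"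
  unfolding free_rank_def by (intro card_mono) auto

lemma free_rank_Suc: "free_rank S (Suc i) = (if Suc i \<in> S then free_rank S i else Suc (free_rank S i))"
proof -
  have "{1..Suc i} - S = (if Suc i \<in> S then {1..i} - S else insert (Suc i) ({1..i} - S))"
    by (auto simp: le_Suc_eq)
  then show ?thesis unfolding free_rank_def by auto
qed

lemma free_rank_less_iff:
  assumes "i \<notin> S" "j \<notin> S" "1 \<le> i" "1 \<le> j"
  shows "free_rank S i < free_rank S j \<longleftrightarrow> i < j"
proof -
  have less: "free_rank S i < free_rank S j" if "i < j" "j \<notin> S" for i j
  proof -
    have "free_rank S i \<le> free_rank S (j - 1)" using that by (intro free_rank_mono) auto
    also have "\<dots> < free_rank S j" using free_rank_Suc[of S "j - 1"] that by auto
    finally show ?thesis .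
  qed
  show ?thesis
  proof
    assume "free_rank S i < free_rank S j"
    then show "i < j" using free_rank_mono[of j i S] by force
  qed (rule less[OF _ assms(2)])
qed

lemma bij_betw_free_rank:
  assumes S: "S \<subseteq> {1..n}"
  shows "bij_betw (free_rank S) ({1..n} - S) {1..n - card S}"
proof -
  have inj: "inj_on (free_rank S) ({1..n} - S)"
  proof (rule inj_onI)
    fix i j assume "i \<in> {1..n} - S" "j \<in> {1..n} - S" "free_rank S i = free_rank S j"
    then show "i = j"
      using free_rank_less_iff[of i S j] free_rank_less_iff[of j S i] by (cases i j rule: linorder_cases) auto
  qed
  have top: "free_rank S n = n - card S"
    using S finite_subset[OF S] by (simp add: free_rank_def card_Diff_subset)
  have "free_rank S ` ({1..n} - S) \<subseteq> {1..n - card S}"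
  proof
    fix x assume "x \<in> free_rank S ` ({1..n} - S)"
    then obtain i where i: "x = free_rank S i" "i \<in> {1..n} - S" by auto
    have "i \<in> {1..i} - S" using i by auto
    then have "{1..i} - S \<noteq> {}" by blast
    then have "1 \<le> x" unfolding i(1) free_rank_def by (simp add: One_nat_def Suc_le_eq card_gt_0_iff del: Diff_eq_empty_iff)
    moreover have "x \<le> n - card S" using free_rank_mono[of i n S] i top by auto
    ultimately show "x \<in> {1..n - card S}" by simp
  qed
  moreover have "card ({1..n} - S) = card {1..n - card S}"
    using top by (simp add: free_rank_def)
  ultimately have "free_rank S ` ({1..n} - S) = {1..n - card S}"
    using card_image[OF inj] by (intro card_subset_eq) auto
  then show ?thesis using inj by (simp add: bij_betw_def)
qed

lemma length_colored_perms: "w \<in> colored_perms r n \<Longrightarrow> length w = n"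
  using length_finite_permutations_of_set[of "map fst w" "{1..n}"] by (simp add: colored_perms_def)

text \<open>
  The set-based definition of a colored permutation is traded for a bijection of the positions,
  which is the form that restricts to the set of unfixed positions.
\<close>

lemma colored_perms_iff:
  "w \<in> colored_perms r n \<longleftrightarrow>
     length w = n \<and> bij_betw (\<lambda>i. fst (w ! (i - 1))) {1..n} {1..n} \<and> (\<forall>i\<in>{1..n}. snd (w ! (i - 1)) < r)"
proof -
  have im: "f ` set w = (\<lambda>i. f (w ! (i - 1))) ` {1..length w}" for f :: "nat \<times> nat \<Rightarrow> nat"
  proof -
    have "set w = (\<lambda>i. w ! (i - 1)) ` {1..length w}"
    proof (intro equalityI subsetI)
      fix x assume "x \<in> set w"
      then obtain i where "i < length w" "x = w ! i" by (auto simp: in_set_conv_nth)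
      then show "x \<in> (\<lambda>i. w ! (i - 1)) ` {1..length w}" by (intro image_eqI[of _ _ "Suc i"]) auto
    qed auto
    then show ?thesis by (simp add: image_image)
  qed
  have dist: "distinct (map fst w) \<longleftrightarrow> inj_on (\<lambda>i. fst (w ! (i - 1))) {1..length w}"
  proof -
    have "map fst w = map (\<lambda>i. fst (w ! (i - 1))) [1..<Suc (length w)]"
      by (rule nth_equalityI) (auto simp del: upt_Suc)
    then show ?thesis
      by (simp add: distinct_map atLeastLessThanSuc_atLeastAtMost del: upt_Suc)
  qed
  have "(\<forall>x\<in>set w. snd x < r) \<longleftrightarrow> (\<forall>i\<in>{1..length w}. snd (w ! (i - 1)) < r)"
    using im[of snd] by (metis (no_types, lifting) image_iff)
  then have "length w = n \<Longrightarrow> ?thesis"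
    by (simp add: colored_perms_def permutations_of_set_def bij_betw_def im dist conj_commute)
  then show ?thesis using length_colored_perms by blast
qed

definition derangements :: "nat \<Rightarrow> nat \<Rightarrow> colored_word set" where
  "derangements r n = {w \<in> colored_perms r n. Fix w = {}}"

lemma nth_nths:
  "i < length xs \<Longrightarrow> i \<in> I \<Longrightarrow> nths xs I ! card {j. j < i \<and> j \<in> I} = xs ! i"
proof (induction xs arbitrary: i I)
  case (Cons x xs)
  show ?case
  proof (cases i)
    case 0
    then show ?thesis using Cons.prems by (simp add: nths_Cons)
  next
    case (Suc i')
    have "{j. j < i \<and> j \<in> I} = (if 0 \<in> I then {0} else {}) \<union> Suc ` {j. j < i' \<and> Suc j \<in> I}"
      using Suc by (auto simp: image_iff gr0_conv_Suc less_Suc_eq_0_disj)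
    then have "card {j. j < i \<and> j \<in> I} = (if 0 \<in> I then 1 else 0) + card {j. j < i' \<and> Suc j \<in> I}"
      by (auto simp: card_image)
    then show ?thesis
      using Cons.IH[of i' "{j. Suc j \<in> I}"] Cons.prems Suc by (simp add: nths_Cons)
  qed
qed simp

lemma sum_list_nths:
  "(\<And>i. i < length xs \<Longrightarrow> i \<notin> I \<Longrightarrow> f (xs ! i) = 0) \<Longrightarrow>
     sum_list (map f (nths xs I)) = (sum_list (map f xs) :: nat)"
proof (induction xs arbitrary: I)
  case (Cons x xs)
  have "sum_list (map f (nths xs {j. Suc j \<in> I})) = sum_list (map f xs)"
    using Cons.prems[of "Suc _"] by (intro Cons.IH) auto
  then show ?case using Cons.prems[of 0] by (auto simp: nths_Cons)
qed simp

context
  fixes r n :: nat and w :: colored_word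
  assumes w: "w \<in> colored_perms r n"
begin

lemma Fix_subset: "Fix w \<subseteq> {1..n}"
  using w unfolding Fix_def colored_perms_iff by blast

lemma fst_nth_not_Fix:
  assumes "i \<in> {1..n} - Fix w"
  shows "fst (w ! (i - 1)) \<in> {1..n} - Fix w"
proof -
  let ?f = "\<lambda>i. fst (w ! (i - 1))"
  have bij: "bij_betw ?f {1..n} {1..n}" and len: "length w = n" using w by (auto simp: colored_perms_iff)
  have "?f i \<in> {1..n}" using bij_betwE[OF bij] assms by blast
  moreover have "?f i \<notin> Fix w"
  proof
    assume f: "?f i \<in> Fix w"
    then have "?f (?f i) = ?f i" by (simp add: Fix_def)
    then have "?f i = i"
      using bij_betw_imp_inj_on[OF bij] assms \<open>?f i \<in> {1..n}\<close> by (auto dest: inj_onD)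
    then show False using f assms by auto
  qed
  ultimately show ?thesis by blast
qed

lemma bij_betw_fst_not_Fix: "bij_betw (\<lambda>i. fst (w ! (i - 1))) ({1..n} - Fix w) ({1..n} - Fix w)"
proof -
  let ?f = "\<lambda>i. fst (w ! (i - 1))"
  have "inj_on ?f ({1..n} - Fix w)"
    using w by (auto simp: colored_perms_iff bij_betw_def intro: inj_on_subset)
  moreover have "?f ` ({1..n} - Fix w) \<subseteq> {1..n} - Fix w" using fst_nth_not_Fix by blast
  ultimately show ?thesis by (simp add: bij_betw_def endo_inj_surj)
qed

lemma length_delete_fixed: "length (delete_fixed w) = n - card (Fix w)"
proof -
  have len: "length w = n" using w by (simp add: colored_perms_iff)
  have "Suc ` {i. i < n \<and> Suc i \<notin> Fix w} = {1..n} - Fix w"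
  proof (intro equalityI subsetI)
    fix x assume "x \<in> {1..n} - Fix w"
    then show "x \<in> Suc ` {i. i < n \<and> Suc i \<notin> Fix w}" by (intro image_eqI[of _ _ "x - 1"]) auto
  qed auto
  then have "card {i. i < n \<and> Suc i \<notin> Fix w} = card ({1..n} - Fix w)"
    using card_image[of Suc "{i. i < n \<and> Suc i \<notin> Fix w}"] by simp
  also have "\<dots> = n - card (Fix w)"
    using Fix_subset by (simp add: card_Diff_subset finite_subset[OF Fix_subset])
  finally show ?thesis using len by (simp add: delete_fixed_def renumber_def length_nths)
qed

text \<open>
  Positions and values are renumbered by the same map, since the absolute values that survive are
  exactly the surviving positions. So deleting the fixed letters conjugates the rest of the colored
  permutation by an order isomorphism; in particular it preserves whether a letter lies above,
  on or below its position.
\<close>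

lemma nth_delete_fixed:
  assumes i: "i \<in> {1..n} - Fix w"
  shows "delete_fixed w ! (free_rank (Fix w) i - 1)
           = (free_rank (Fix w) (fst (w ! (i - 1))), snd (w ! (i - 1)))"
proof -
  define I where "I = {i. Suc i \<notin> Fix w}"
  have len: "length w = n" using w by (simp add: colored_perms_iff)
  have nth: "nths w I ! (free_rank (Fix w) i - 1) = w ! (i - 1)" if i: "i \<in> {1..n} - Fix w" for i
  proof -
    have "Suc ` {j. j < i - 1 \<and> j \<in> I} = {1..i - 1} - Fix w"
    proof (intro equalityI subsetI)
      fix x assume "x \<in> {1..i - 1} - Fix w"
      then show "x \<in> Suc ` {j. j < i - 1 \<and> j \<in> I}"
        by (intro image_eqI[of _ _ "x - 1"]) (auto simp: I_def)
    qed (auto simp: I_def)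
    then have "card {j. j < i - 1 \<and> j \<in> I} = free_rank (Fix w) (i - 1)"
      unfolding free_rank_def using card_image[of Suc "{j. j < i - 1 \<and> j \<in> I}"] by simp
    also have "\<dots> = free_rank (Fix w) i - 1"
      using free_rank_Suc[of "Fix w" "i - 1"] i by auto
    finally show ?thesis
      using nth_nths[of "i - 1" w I] i len by (auto simp: I_def)
  qed
  have bij: "bij_betw (free_rank (Fix w)) ({1..n} - Fix w) {1..n - card (Fix w)}"
    by (rule bij_betw_free_rank[OF Fix_subset])
  have lenI: "length (nths w I) = n - card (Fix w)"
    using length_delete_fixed by (simp add: delete_fixed_def renumber_def I_def)
  have "set (nths w I) = (\<lambda>i. w ! (i - 1)) ` ({1..n} - Fix w)"
  proof (intro equalityI subsetI)
    fix x assume "x \<in> set (nths w I)"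
    then obtain j where j: "j < n - card (Fix w)" "x = nths w I ! j"
      using lenI by (auto simp: in_set_conv_nth)
    then have "Suc j \<in> free_rank (Fix w) ` ({1..n} - Fix w)"
      using bij by (simp add: bij_betw_def)
    then obtain i where "i \<in> {1..n} - Fix w" "free_rank (Fix w) i = Suc j" by auto
    then show "x \<in> (\<lambda>i. w ! (i - 1)) ` ({1..n} - Fix w)" using nth[of i] j by auto
  next
    fix x assume "x \<in> (\<lambda>i. w ! (i - 1)) ` ({1..n} - Fix w)"
    then obtain i where i: "i \<in> {1..n} - Fix w" "x = w ! (i - 1)" by auto
    then show "x \<in> set (nths w I)"
      using nth[OF i(1)] bij_betwE[OF bij] lenI by (metis (no_types, lifting) Suc_pred' Suc_le_eq atLeastAtMost_iff nth_mem One_nat_def)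
  qed
  then have "fst ` set (nths w I) = {1..n} - Fix w"
    using bij_betw_fst_not_Fix by (simp add: bij_betw_def image_image)
  moreover have "{b \<in> {1..n} - Fix w. b \<le> a} = {1..a} - Fix w" if "a \<le> n" for a
    using that by auto
  moreover have "fst (w ! (i - 1)) \<le> n" using fst_nth_not_Fix[OF i] by auto
  moreover have "free_rank (Fix w) i - 1 < length (nths w I)"
    using bspec[OF bij_betwE[OF bij] i] lenI by auto
  ultimately show ?thesis
    using nth[OF i] unfolding delete_fixed_def renumber_def I_def[symmetric]
    by (simp add: free_rank_def case_prod_beta)
qed

lemma delete_fixed_derangement: "delete_fixed w \<in> derangements r (n - card (Fix w))"
proof -
  let ?D = "{1..n} - Fix w" and ?m = "n - card (Fix w)" and ?\<rho> = "free_rank (Fix w)"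
  let ?g = "\<lambda>j. fst (delete_fixed w ! (j - 1))" and ?f = "\<lambda>i. fst (w ! (i - 1))"
  have bij: "bij_betw ?\<rho> ?D {1..?m}" by (rule bij_betw_free_rank[OF Fix_subset])
  have "bij_betw (?\<rho> \<circ> ?f) ?D {1..?m}"
    by (rule bij_betw_trans[OF bij_betw_fst_not_Fix bij])
  then have "bij_betw (?g \<circ> ?\<rho>) ?D {1..?m}"
    by (rule bij_betw_cong[THEN iffD1, rotated]) (simp add: nth_delete_fixed[unfolded Diff_iff])
  then have g: "bij_betw ?g {1..?m} {1..?m}"
    using bij_betw_comp_iff[OF bij] by blast
  have preim: "\<exists>i\<in>?D. j = ?\<rho> i" if "j \<in> {1..?m}" for j
    using that bij by (auto simp: bij_betw_def)
  have col: "snd (delete_fixed w ! (j - 1)) < r" if "j \<in> {1..?m}" for j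
    using preim[OF that] w by (auto simp: nth_delete_fixed colored_perms_iff)
  have "j \<notin> Fix (delete_fixed w)" for j
  proof
    assume j: "j \<in> Fix (delete_fixed w)"
    then have "j \<in> {1..?m}" by (auto simp: Fix_def length_delete_fixed)
    then obtain i where i: "i \<in> ?D" "j = ?\<rho> i" using preim by blast
    have "?\<rho> (?f i) = ?\<rho> i" "snd (w ! (i - 1)) = 0"
      using j i nth_delete_fixed[OF i(1)] by (auto simp: Fix_def)
    moreover from this have "?f i = i"
      using bij i fst_nth_not_Fix[OF i(1)] by (auto simp: bij_betw_def inj_on_def)
    ultimately have "w ! (i - 1) = (i, 0)" by (metis prod.collapse)
    then have "i \<in> Fix w" using i w by (auto simp: Fix_def colored_perms_iff)
    then show False using i by simp
  qed
  then show ?thesis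
    using g col length_delete_fixed by (auto simp: derangements_def colored_perms_iff)
qed

lemma sum_list_colors_delete_fixed:
  "sum_list (map snd (delete_fixed w)) = sum_list (map snd w)"
proof -
  have "map snd (delete_fixed w) = map snd (nths w {i. Suc i \<notin> Fix w})"
    by (simp add: delete_fixed_def renumber_def case_prod_beta comp_def)
  moreover have "sum_list (map snd (nths w {i. Suc i \<notin> Fix w})) = sum_list (map snd w)"
    by (rule sum_list_nths) (auto simp: Fix_def)
  ultimately show ?thesis by simp
qed

end

text \<open>The inverse of deleting fixed letters: conjugation back, with fixed letters put at \<open>S\<close>.\<close>

definition insert_fixed :: "nat \<Rightarrow> nat set \<Rightarrow> colored_word \<Rightarrow> colored_word" where
  "insert_fixed n S v = map (\<lambda>i. if i \<in> S then (i, 0) else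
     let (a, z) = v ! (free_rank S i - 1) in (the_inv_into ({1..n} - S) (free_rank S) a, z)) [1..<Suc n]"

lemma insert_fixed:
  assumes S: "S \<subseteq> {1..n}" and v: "v \<in> derangements r (n - card S)" and "r \<ge> 1"
  shows "insert_fixed n S v \<in> colored_perms r n" "Fix (insert_fixed n S v) = S"
    "delete_fixed (insert_fixed n S v) = v"
proof -
  let ?D = "{1..n} - S" and ?m = "n - card S" and ?\<rho> = "free_rank S"
  let ?w = "insert_fixed n S v"
  define e where "e = the_inv_into ?D ?\<rho>"
  have bij: "bij_betw ?\<rho> ?D {1..?m}" by (rule bij_betw_free_rank[OF S])
  have e: "bij_betw e {1..?m} ?D" unfolding e_def by (rule bij_betw_the_inv_into[OF bij])
  have \<rho>e: "?\<rho> (e a) = a" if "a \<in> {1..?m}" for a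
    using that bij unfolding e_def by (auto simp: bij_betw_def f_the_inv_into_f)
  have len: "length ?w = n" by (simp add: insert_fixed_def)
  have nth_S: "?w ! (i - 1) = (i, 0)" if "i \<in> S" for i
    using that subsetD[OF S that] unfolding insert_fixed_def by (subst nth_map) (auto simp del: upt_Suc)
  have nth_D: "?w ! (i - 1) = (e (fst (v ! (?\<rho> i - 1))), snd (v ! (?\<rho> i - 1)))" if "i \<in> ?D" for i
    using that unfolding insert_fixed_def e_def
    by (subst nth_map) (auto simp: case_prod_beta Let_def simp del: upt_Suc)
  have vbij: "bij_betw (\<lambda>j. fst (v ! (j - 1))) {1..?m} {1..?m}" and vlen: "length v = ?m"
    and vcol: "\<And>j. j \<in> {1..?m} \<Longrightarrow> snd (v ! (j - 1)) < r" and vfix: "Fix v = {}"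
    using v by (auto simp: derangements_def colored_perms_iff)
  have \<rho>m: "?\<rho> i \<in> {1..?m}" if "i \<in> ?D" for i using bij_betwE[OF bij] that by blast
  have "bij_betw (\<lambda>i. fst (?w ! (i - 1))) S S"
    by (rule bij_betw_cong[THEN iffD1, OF _ bij_betw_id]) (simp add: nth_S)
  moreover have "bij_betw (\<lambda>i. fst (?w ! (i - 1))) ?D ?D"
    by (rule bij_betw_cong[THEN iffD1, OF _ bij_betw_trans[OF bij bij_betw_trans[OF vbij e]]])
       (simp add: nth_D)
  ultimately have "bij_betw (\<lambda>i. fst (?w ! (i - 1))) (S \<union> ?D) (S \<union> ?D)"
    by (rule bij_betw_combine) blast
  moreover have "S \<union> ?D = {1..n}" using S by blast
  moreover have "snd (?w ! (i - 1)) < r" if "i \<in> {1..n}" for i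
    using that vcol[OF \<rho>m] nth_S nth_D \<open>r \<ge> 1\<close> by (cases "i \<in> S") auto
  ultimately show w: "?w \<in> colored_perms r n" using len by (simp add: colored_perms_iff)
  have "i \<notin> Fix ?w" if i: "i \<in> ?D" for i
  proof
    assume "i \<in> Fix ?w"
    then have "e (fst (v ! (?\<rho> i - 1))) = i" "snd (v ! (?\<rho> i - 1)) = 0"
      using nth_D[OF i] by (auto simp: Fix_def)
    moreover have "fst (v ! (?\<rho> i - 1)) \<in> {1..?m}" using bij_betwE[OF vbij] \<rho>m[OF i] by blast
    ultimately have "v ! (?\<rho> i - 1) = (?\<rho> i, 0)" using \<rho>e by (metis prod.collapse)
    then have "?\<rho> i \<in> Fix v" using \<rho>m[OF i] vlen by (simp add: Fix_def)
    then show False using vfix by simp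
  qed
  moreover have "S \<subseteq> Fix ?w" using S nth_S len by (auto simp: Fix_def)
  moreover have "Fix ?w \<subseteq> {1..n}" using Fix_subset[OF w] .
  ultimately show F: "Fix ?w = S" by blast
  show "delete_fixed ?w = v"
  proof (rule nth_equalityI)
    show "length (delete_fixed ?w) = length v" using length_delete_fixed[OF w] F vlen by simp
    fix j assume "j < length (delete_fixed ?w)"
    then have j: "Suc j \<in> {1..?m}" using length_delete_fixed[OF w] F by simp
    then obtain i where i: "i \<in> ?D" "?\<rho> i = Suc j" using bij_betw_imp_surj_on[OF bij] by (metis imageE)
    have "fst (v ! j) \<in> {1..?m}" using bspec[OF bij_betwE[OF vbij] j] by simp
    then show "delete_fixed ?w ! j = v ! j"
      using nth_delete_fixed[OF w, of i] i nth_D[OF i(1)] \<rho>e by (simp add: F)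
  qed
qed

lemma eq_if_delete_fixed_eq:
  assumes w: "w \<in> colored_perms r n" and w': "w' \<in> colored_perms r n"
    and F: "Fix w = Fix w'" and d: "delete_fixed w = delete_fixed w'"
  shows "w = w'"
proof (rule nth_equalityI)
  show "length w = length w'" using w w' by (simp add: colored_perms_iff)
  fix j assume "j < length w"
  then have j: "Suc j \<in> {1..n}" using w by (simp add: colored_perms_iff)
  show "w ! j = w' ! j"
  proof (cases "Suc j \<in> Fix w")
    case True
    then have "Suc j \<in> Fix w'" using F by simp
    then show ?thesis using True unfolding Fix_def by simp
  next
    case False
    have a: "fst (w ! j) \<in> {1..n} - Fix w" "fst (w' ! j) \<in> {1..n} - Fix w"
      using fst_nth_not_Fix[OF w, of "Suc j"] fst_nth_not_Fix[OF w', of "Suc j"] j False F by auto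
    have "free_rank (Fix w) (fst (w ! j)) = free_rank (Fix w) (fst (w' ! j))"
      "snd (w ! j) = snd (w' ! j)"
      using nth_delete_fixed[OF w, of "Suc j"] nth_delete_fixed[OF w', of "Suc j"] j False F d by auto
    then show ?thesis
      using a bij_betw_free_rank[OF Fix_subset[OF w]] by (auto simp: bij_betw_def inj_on_def prod_eq_iff)
  qed
qed

text \<open>
  A colored permutation amounts to its set of fixed positions together with a derangement of the
  remaining ones. The sum over the sets is innermost because both statistics become
  \<open>q\<close>-binomial coefficients once the derangement is held fast.
\<close>

lemma sum_colored_perms_by_fixed:
  fixes g :: "nat set \<Rightarrow> colored_word \<Rightarrow> 'a::comm_ring_1"
  assumes "r \<ge> 1"
  shows "(\<Sum>w\<in>colored_perms r n. g (Fix w) (delete_fixed w))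
       = (\<Sum>k\<le>n. \<Sum>v\<in>derangements r (n - k). \<Sum>S\<in>ksubsets n k. g S v)"
proof -
  have fin: "finite (derangements r m)" for m
    using finite_colored_perms by (simp add: derangements_def)
  have "(\<Sum>w\<in>colored_perms r n. g (Fix w) (delete_fixed w))
      = (\<Sum>(S, v)\<in>(SIGMA S:Pow {1..n}. derangements r (n - card S)). g S v)"
  proof (rule sum.reindex_bij_witness[where j = "\<lambda>w. (Fix w, delete_fixed w)"
        and i = "\<lambda>(S, v). insert_fixed n S v"])
    fix w assume w: "w \<in> colored_perms r n"
    have d: "delete_fixed w \<in> derangements r (n - card (Fix w))" by (rule delete_fixed_derangement[OF w])
    show "(Fix w, delete_fixed w) \<in> (SIGMA S:Pow {1..n}. derangements r (n - card S))"
      using Fix_subset[OF w] d by blast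
    show "(case (Fix w, delete_fixed w) of (S, v) \<Rightarrow> insert_fixed n S v) = w"
      using insert_fixed[OF Fix_subset[OF w] d assms] eq_if_delete_fixed_eq w by auto
  qed (use insert_fixed[OF _ _ assms] in auto)
  also have "\<dots> = (\<Sum>S\<in>Pow {1..n}. \<Sum>v\<in>derangements r (n - card S). g S v)"
    by (rule sum.Sigma[symmetric]) (simp_all add: fin)
  also have "\<dots> = (\<Sum>k\<le>n. \<Sum>S\<in>{S \<in> Pow {1..n}. card S = k}. \<Sum>v\<in>derangements r (n - card S). g S v)"
    by (rule sum.group[symmetric]) (use card_mono[of "{1..n}"] in auto)
  also have "\<dots> = (\<Sum>k\<le>n. \<Sum>S\<in>ksubsets n k. \<Sum>v\<in>derangements r (n - k). g S v)"
    by (intro sum.cong) (auto simp: ksubsets_def)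
  also have "\<dots> = (\<Sum>k\<le>n. \<Sum>v\<in>derangements r (n - k). \<Sum>S\<in>ksubsets n k. g S v)"
    by (intro sum.cong refl sum.swap)
  finally show ?thesis .
qed

section \<open>Descents and equidistribution\<close>

text \<open>
  An integer code for the letters of a derangement in which \<open>0\<close> is free to stand for a fixed letter:
  uncolored letters above their position become positive, all others negative, and within each
  of the two classes the order of the letters is kept. The value \<open>- 1\<close> outside the word only has
  to differ from \<open>0\<close>.
\<close>

definition letter_key :: "colored_word \<Rightarrow> nat \<Rightarrow> int" where
  "letter_key v j =
     (if j \<in> {1..length v} then
        let (a, z) = v ! (j - 1)
        in if z = 0 \<and> j < a then int a else int a - int (Suc (length v)) * (int z + 1)
      else - 1)"

lemma letter_key_pos_iff:
  assumes v: "v \<in> colored_perms r m" and j: "j \<in> {1..m}"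
  shows "0 < letter_key v j \<longleftrightarrow> snd (v ! (j - 1)) = 0 \<and> j < fst (v ! (j - 1))"
    and "letter_key v j \<noteq> 0"
proof -
  obtain a z where az: "v ! (j - 1) = (a, z)" by fastforce
  have len: "length v = m" using v by (simp add: colored_perms_iff)
  have "fst (v ! (j - 1)) \<in> {1..m}" using v j by (auto simp: colored_perms_iff bij_betw_def)
  then have a: "1 \<le> a" "a \<le> m" using az by auto
  have "int (Suc m) * 1 \<le> int (Suc m) * (int z + 1)" by (intro mult_left_mono) auto
  moreover have "int a < int (Suc m) * 1" using a by simp
  ultimately have "int a < int (Suc m) * (int z + 1)" by (rule less_le_trans[rotated])
  then have "int a - int (Suc m) * (int z + 1) < 0" by (simp only: diff_less_0_iff_less)
  then show "0 < letter_key v j \<longleftrightarrow> snd (v ! (j - 1)) = 0 \<and> j < fst (v ! (j - 1))"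
    "letter_key v j \<noteq> 0"
    using j a by (simp_all only: letter_key_def len az) auto
qed

lemma letter_key_nonzero: "v \<in> colored_perms r m \<Longrightarrow> letter_key v j \<noteq> 0"
  using letter_key_pos_iff(2)[of v r m j]
  by (cases "j \<in> {1..m}") (auto simp: letter_key_def colored_perms_iff)

text \<open>
  Moving the uncolored letters above their position to the top preserves descents: such a letter
  at \<open>j\<close> exceeds \<open>j\<close>, while a letter of the other class at \<open>j + 1\<close> is colored or, since nothing
  is fixed, at most \<open>j\<close>; and similarly with the classes exchanged.
\<close>

lemma letter_key_less_iff:
  assumes v: "v \<in> derangements r m" and j: "1 \<le> j" "Suc j \<le> m"
  shows "letter_key v (Suc j) < letter_key v j \<longleftrightarrow> letter_less (v ! j) (v ! (j - 1))"
proof -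
  obtain a z where az: "v ! (j - 1) = (a, z)" by fastforce
  obtain b y where b_y: "v ! j = (b, y)" by fastforce
  have len: "length v = m" and bij: "bij_betw (\<lambda>i. fst (v ! (i - 1))) {1..m} {1..m}"
    and noFix: "Fix v = {}"
    using v by (auto simp: derangements_def colored_perms_iff)
  have jm: "j \<in> {1..m}" "Suc j \<in> {1..m}" using j by auto
  have ab: "a \<in> {1..m}" "b \<in> {1..m}"
    using bspec[OF bij_betwE[OF bij] jm(1)] bspec[OF bij_betwE[OF bij] jm(2)] az b_y by auto
  have "a \<noteq> b"
    using inj_onD[OF bij_betw_imp_inj_on[OF bij], of j "Suc j"] jm az b_y by auto
  have nf: "z = 0 \<Longrightarrow> a \<noteq> j" "y = 0 \<Longrightarrow> b \<noteq> Suc j"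
    using noFix jm az b_y len unfolding Fix_def by auto
  \<comment> \<open>The offset of color \<open>c\<close>; offsets of different colors differ by more than any absolute value.\<close>
  define P where "P = (\<lambda>c::nat. int (Suc m) * (int c + 1))"
  have P: "P c + int (Suc m) \<le> P d" if "c < d" for c d
  proof -
    have "int (Suc m) * (int c + 2) \<le> int (Suc m) * (int d + 1)"
      using that by (intro mult_left_mono) auto
    then show ?thesis unfolding P_def by (simp add: algebra_simps)
  qed
  have P0: "int (Suc m) \<le> P c" for c
    using mult_left_mono[of 1 "int c + 1" "int (Suc m)"] by (simp add: P_def)
  have K: "letter_key v j = (if z = 0 \<and> j < a then int a else int a - P z)"
    "letter_key v (Suc j) = (if y = 0 \<and> Suc j < b then int b else int b - P y)"
    using jm az b_y unfolding letter_key_def len P_def by auto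
  have "letter_key v (Suc j) < letter_key v j \<longleftrightarrow> z < y \<or> (y = z \<and> b < a)"
    using ab \<open>a \<noteq> b\<close> nf P[of z y] P[of y z] P0[of z] P0[of y] unfolding K
    by (cases y z rule: linorder_cases) auto
  then show ?thesis using az b_y by (simp add: letter_less_def)
qed

lemma shuffle_letter_free_rank:
  "shuffle_letter K S i = (if i \<in> S then 0 else K (free_rank S i))"
  by (simp add: shuffle_letter_def free_rank_def)

text \<open>
  The same exchange argument with a fixed letter as one of the two neighbours. An unfixed letter
  next to the fixed letter \<open>i\<close> does not have absolute value \<open>i\<close> and, if uncolored, differs from its
  own position. So it is larger than \<open>i\<close> exactly if it is uncolored and larger than its own
  position, that is, if its key exceeds \<open>0\<close>. Hence the colored permutation has the descents of the
  shuffle of its derangement with zeros at its fixed positions.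
\<close>

lemma letter_less_iff_shuffle_letter:
  assumes w: "w \<in> colored_perms r n" and i: "1 \<le> i" "i < n"
  defines "K \<equiv> letter_key (delete_fixed w)"
  shows "letter_less (w ! i) (w ! (i - 1)) \<longleftrightarrow>
    shuffle_letter K (Fix w) (Suc i) < shuffle_letter K (Fix w) i"
proof -
  let ?S = "Fix w" and ?v = "delete_fixed w" and ?\<rho> = "free_rank (Fix w)"
  let ?D = "{1..n} - ?S" and ?m = "n - card (Fix w)"
  have len: "length w = n" using w by (simp add: colored_perms_iff)
  have v: "?v \<in> derangements r ?m" by (rule delete_fixed_derangement[OF w])
  then have v': "?v \<in> colored_perms r ?m" by (simp add: derangements_def)
  have \<rho>m: "?\<rho> h \<in> {1..?m}" if "h \<in> ?D" for h
    using bspec[OF bij_betwE[OF bij_betw_free_rank[OF Fix_subset[OF w]]] that] .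
  obtain a z where az: "w ! (i - 1) = (a, z)" by fastforce
  obtain b y where b_y: "w ! i = (b, y)" by fastforce
  have pos: "0 < K (?\<rho> h) \<longleftrightarrow> snd (w ! (h - 1)) = 0 \<and> h < fst (w ! (h - 1))" if h: "h \<in> ?D" for h
    using letter_key_pos_iff(1)[OF v' \<rho>m[OF h]] fst_nth_not_Fix[OF w h] h
    by (simp add: K_def nth_delete_fixed[OF w h] free_rank_less_iff)
  have nz: "K j \<noteq> 0" for j unfolding K_def by (rule letter_key_nonzero[OF v'])
  have S: "h \<in> ?S \<longleftrightarrow> w ! (h - 1) = (h, 0)" if "h \<in> {1..n}" for h
    using that len by (simp add: Fix_def)
  have in_n: "i \<in> {1..n}" "Suc i \<in> {1..n}" using i by auto
  have ai: "a \<in> ?D" if "i \<notin> ?S" using fst_nth_not_Fix[OF w, of i] that in_n az by simp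
  have bi: "b \<in> ?D" if "Suc i \<notin> ?S" using fst_nth_not_Fix[OF w, of "Suc i"] that in_n b_y by simp
  show ?thesis
  proof (cases "i \<in> ?S")
    case iS: True
    then have az': "a = i" "z = 0" using S in_n az by auto
    show ?thesis
    proof (cases "Suc i \<in> ?S")
      case True
      then have "b = Suc i" "y = 0" using S[OF in_n(2)] b_y by auto
      then show ?thesis using iS True az b_y az' by (simp add: letter_less_def shuffle_letter_def)
    next
      case False
      have "b \<noteq> i" using bi[OF False] iS by auto
      moreover have "b \<noteq> Suc i" if "y = 0" using False S[OF in_n(2)] b_y that by auto
      moreover have "K (?\<rho> (Suc i)) < 0 \<longleftrightarrow> \<not> (y = 0 \<and> Suc i < b)"
        using pos[of "Suc i"] nz[of "?\<rho> (Suc i)"] False in_n b_y by auto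
      ultimately show ?thesis
        using iS False az b_y az' by (auto simp: letter_less_def shuffle_letter_free_rank)
    qed
  next
    case iS: False
    show ?thesis
    proof (cases "Suc i \<in> ?S")
      case True
      then have "b = Suc i" "y = 0" using S[OF in_n(2)] b_y by auto
      moreover have "a \<noteq> Suc i" using ai[OF iS] True by auto
      ultimately show ?thesis
        using iS True az b_y pos[of i] in_n by (auto simp: letter_less_def shuffle_letter_free_rank)
    next
      case False
      let ?j = "?\<rho> i"
      have iD: "i \<in> ?D" "Suc i \<in> ?D" using iS False in_n by auto
      have \<rho>i: "?\<rho> (Suc i) = Suc ?j" using False by (simp add: free_rank_Suc)
      have "K (Suc ?j) < K ?j \<longleftrightarrow> letter_less (?v ! ?j) (?v ! (?j - 1))"
        unfolding K_def using \<rho>m[OF iD(1)] \<rho>m[OF iD(2)] \<rho>i by (intro letter_key_less_iff[OF v]) auto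
      also have "?v ! ?j = (?\<rho> b, y)" using nth_delete_fixed[OF w iD(2)] \<rho>i b_y by simp
      also have "?v ! (?j - 1) = (?\<rho> a, z)" using nth_delete_fixed[OF w iD(1)] az by simp
      also have "letter_less (?\<rho> b, y) (?\<rho> a, z) \<longleftrightarrow> letter_less (b, y) (a, z)"
        using ai[OF iS] bi[OF False] by (simp add: letter_less_def free_rank_less_iff)
      finally show ?thesis
        using iS False az b_y \<rho>i by (simp add: shuffle_letter_free_rank)
    qed
  qed
qed

lemma maj_eq_shuffle_maj:
  assumes w: "w \<in> colored_perms r n"
  shows "maj w = shuffle_maj (letter_key (delete_fixed w)) n (Fix w)"
proof -
  have "length w = n" using w by (simp add: colored_perms_iff)
  then show ?thesis
    unfolding maj_def shuffle_maj_def
    using letter_less_iff_shuffle_letter[OF w]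
    by (intro arg_cong[where f = "\<lambda>A. \<Sum>A"] Collect_cong) auto
qed

lemma maj_derangement_eq_shuffle_maj:
  assumes v: "v \<in> derangements r m"
  shows "maj v = shuffle_maj (letter_key v) m {}"
proof -
  have "length v = m" using v by (simp add: derangements_def colored_perms_iff)
  then show ?thesis
    unfolding maj_def shuffle_maj_def
    using letter_key_less_iff[OF v]
    by (intro arg_cong[where f = "\<lambda>A. \<Sum>A"] Collect_cong) (auto simp: shuffle_letter_def)
qed

lemma sum_sorted_list_minus_rank:
  assumes S: "S \<subseteq> {1..n}"
  shows "(\<Sum>j = 1..card S. sorted_list_of_set S ! (j - 1) - j) = (\<Sum>i\<in>S. card ({1..i} - S))"
proof -
  let ?l = "sorted_list_of_set S"
  have fin: "finite S" using S finite_subset by blast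
  have len: "length ?l = card S" by simp
  have bij: "bij_betw ((!) ?l) {..<card S} S" using fin by (intro bij_betw_nth) auto
  have mono: "?l ! i < ?l ! j \<longleftrightarrow> i < j" if "i < card S" "j < card S" for i j
    using sorted_wrt_nth_less[of "(<)" ?l] that
    by (metis len linorder_neqE_nat order_less_asym order_less_irrefl strict_sorted_list_of_set)
  have "card ({1..?l ! j} - S) = ?l ! j - Suc j" if j: "j < card S" for j
  proof -
    have "{1..?l ! j} \<inter> S = (!) ?l ` {..j}"
    proof (intro equalityI subsetI)
      fix x assume x: "x \<in> {1..?l ! j} \<inter> S"
      then obtain i where i: "i < card S" "x = ?l ! i"
        using bij_betw_imp_surj_on[OF bij] by (metis IntD2 imageE lessThan_iff)
      then have "i \<le> j" using x mono[of j i] j by (metis IntD1 atLeastAtMost_iff linorder_not_less)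
      then show "x \<in> (!) ?l ` {..j}" using i by auto
    next
      fix x assume "x \<in> (!) ?l ` {..j}"
      then obtain i where i: "i \<le> j" "x = ?l ! i" by auto
      have "x \<in> S" using bspec[OF bij_betwE[OF bij], of i] i j by auto
      moreover have "x \<le> ?l ! j" using mono[of j i] i j by (metis leD le_trans linorder_le_less_linear order_le_less_trans)
      ultimately show "x \<in> {1..?l ! j} \<inter> S" using S by auto
    qed
    moreover have "inj_on ((!) ?l) {..j}"
      using bij_betw_imp_inj_on[OF bij] j by (auto intro: inj_on_subset)
    ultimately have "card ({1..?l ! j} \<inter> S) = Suc j" by (simp add: card_image)
    then show ?thesis by (simp add: card_Diff_subset_Int)
  qed
  then have "(\<Sum>j<card S. card ({1..?l ! j} - S)) = (\<Sum>j = 1..card S. ?l ! (j - 1) - j)"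
    by (simp add: One_nat_def sum.atLeast1_atMost_eq)
  moreover have "(\<Sum>j<card S. card ({1..?l ! j} - S)) = (\<Sum>i\<in>S. card ({1..i} - S))"
    by (rule sum.reindex_bij_betw[OF bij])
  ultimately show ?thesis by simp
qed

text \<open>
  For every derangement \<open>v\<close>, the two sums over the sets of fixed positions agree: apart from
  the power of \<open>q\<close> for the colors of \<open>v\<close>, both equal \<open>Q ^ maj v\<close> times the same \<open>Q\<close>-binomial
  coefficient, where \<open>Q = q ^ r\<close>.
\<close>

theorem fmaf_fmaj_equidistributed:
  fixes q :: "'a::comm_ring_1"
  assumes "r \<ge> 1"
  shows "(\<Sum>w\<in>colored_perms r n. q ^ fmaf r w) = (\<Sum>w\<in>colored_perms r n. q ^ fmaj r w)"
proof -
  define Q where "Q = q ^ r"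
  define c where "c = (\<lambda>v :: colored_word. q ^ sum_list (map snd v))"
  have fmaf: "q ^ fmaf r w
      = Q ^ (\<Sum>i\<in>Fix w. card ({1..i} - Fix w)) * (Q ^ maj (delete_fixed w) * c (delete_fixed w))"
    if w: "w \<in> colored_perms r n" for w
    unfolding fmaf_def fmaj_def sum_sorted_list_minus_rank[OF Fix_subset[OF w]] Q_def c_def
    by (simp add: power_add power_mult)
  have fmaj: "q ^ fmaj r w
      = Q ^ shuffle_maj (letter_key (delete_fixed w)) n (Fix w) * c (delete_fixed w)"
    if w: "w \<in> colored_perms r n" for w
    unfolding fmaj_def maj_eq_shuffle_maj[OF w] Q_def c_def sum_list_colors_delete_fixed[OF w]
    by (simp add: power_add power_mult)
  have "(\<Sum>w\<in>colored_perms r n. q ^ fmaf r w)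
      = (\<Sum>k\<le>n. \<Sum>v\<in>derangements r (n - k). \<Sum>S\<in>ksubsets n k.
          Q ^ (\<Sum>i\<in>S. card ({1..i} - S)) * (Q ^ maj v * c v))"
    by (simp add: fmaf sum_colored_perms_by_fixed[OF assms, symmetric])
  also have "\<dots> = (\<Sum>k\<le>n. \<Sum>v\<in>derangements r (n - k). qbinom Q n k * (Q ^ maj v * c v))"
    by (simp only: sum_distrib_right[symmetric] qbinom_eq_sum_ksubsets)
  also have "\<dots> = (\<Sum>k\<le>n. \<Sum>v\<in>derangements r (n - k). \<Sum>S\<in>ksubsets n k.
          Q ^ shuffle_maj (letter_key v) n S * c v)"
  proof (intro sum.cong refl)
    fix k v assume "k \<in> {..n}" and v: "v \<in> derangements r (n - k)"
    then have k: "k \<le> n" by simp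
    have nz: "letter_key v i \<noteq> 0" for i
      using v letter_key_nonzero by (auto simp: derangements_def)
    show "qbinom Q n k * (Q ^ maj v * c v) = (\<Sum>S\<in>ksubsets n k. Q ^ shuffle_maj (letter_key v) n S * c v)"
      unfolding sum_distrib_right[symmetric] sum_shuffle_maj[of "letter_key v", OF nz k]
        maj_derangement_eq_shuffle_maj[OF v] by (simp add: mult_ac)
  qed
  also have "\<dots> = (\<Sum>w\<in>colored_perms r n. q ^ fmaj r w)"
    by (simp add: fmaj sum_colored_perms_by_fixed[OF assms, symmetric])
  finally show ?thesis .
qed

section \<open>The distribution of the flag major index\<close>

definition append_letter :: "nat \<Rightarrow> nat \<Rightarrow> colored_word \<Rightarrow> colored_word" where
  "append_letter j z v = map (\<lambda>(a, y). (if a < j then a else Suc a, y)) v @ [(j, z)]"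

lemma maj_snoc:
  "maj (u @ [x]) = maj u + (if u \<noteq> [] \<and> letter_less x (last u) then length u else 0)"
proof (cases "u = []")
  case True
  then show ?thesis by (simp add: maj_def)
next
  case False
  let ?D = "{i \<in> {1..<length u}. letter_less (u ! i) (u ! (i - 1))}"
  have last: "last u = u ! (length u - 1)" using False by (rule last_conv_nth)
  have "{i \<in> {1..<length (u @ [x])}. letter_less ((u @ [x]) ! i) ((u @ [x]) ! (i - 1))}
      = (if letter_less x (last u) then insert (length u) ?D else ?D)"
    using False by (auto simp: One_nat_def nth_append less_Suc_eq last Suc_le_eq)
  then show ?thesis using False unfolding maj_def by auto
qed

lemma maj_map:
  assumes "\<And>x y. letter_less (f x) (f y) \<longleftrightarrow> letter_less x y"
  shows "maj (map f u) = maj u"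
  unfolding maj_def
  by (intro arg_cong[where f = "\<lambda>A. \<Sum>A"] Collect_cong) (auto simp: assms)

lemma fmaj_append_letter:
  assumes "v \<in> colored_perms r n"
  shows "fmaj r (append_letter j z v) = fmaj r v + z
    + (if v \<noteq> [] \<and> (snd (last v) < z \<or> snd (last v) = z \<and> j \<le> fst (last v)) then r * n else 0)"
proof -
  let ?f = "\<lambda>(a, y :: nat). (if a < j then a else Suc a, y)"
  have "maj (map ?f v) = maj v"
    by (rule maj_map) (auto simp: letter_less_def split: prod.splits)
  moreover have "map snd (map ?f v) = map snd v" by (simp add: case_prod_beta comp_def)
  moreover have "letter_less (j, z) (?f (last v))
      \<longleftrightarrow> snd (last v) < z \<or> snd (last v) = z \<and> j \<le> fst (last v)"
    by (auto simp: letter_less_def split: prod.splits)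
  ultimately show ?thesis
    using length_colored_perms[OF assms]
    by (cases "v = []")
       (simp_all add: append_letter_def fmaj_def maj_snoc[of "[]", simplified] maj_snoc last_map
         algebra_simps del: map_map)
qed

lemma append_letter_colored_perms:
  assumes v: "v \<in> colored_perms r n" and j: "j \<in> {1..Suc n}" and "z < r"
  shows "append_letter j z v \<in> colored_perms r (Suc n)"
proof -
  let ?g = "\<lambda>a. if a < j then a else Suc a"
  have fst_eq: "map fst (append_letter j z v) = map ?g (map fst v) @ [j]"
    by (simp add: append_letter_def case_prod_beta comp_def)
  have set: "set (map fst v) = {1..n}" and dist: "distinct (map fst v)"
    and col: "\<forall>x\<in>set v. snd x < r"
    using v by (auto simp: colored_perms_def permutations_of_set_def)
  have inj: "inj_on ?g A" for A by (auto simp: inj_on_def)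
  have "?g ` {1..n} \<union> {j} = {1..Suc n}"
  proof (intro equalityI subsetI)
    fix x assume x: "x \<in> {1..Suc n}"
    show "x \<in> ?g ` {1..n} \<union> {j}"
    proof (cases x j rule: linorder_cases)
      case less
      then show ?thesis using x j by (intro UnI1 image_eqI[of _ _ x]) auto
    next
      case greater
      then show ?thesis using x j by (intro UnI1 image_eqI[of _ _ "x - 1"]) auto
    qed simp
  qed (use j in \<open>auto split: if_splits\<close>)
  then have "set (map fst (append_letter j z v)) = {1..Suc n}"
    unfolding fst_eq set_append set_map[of ?g] set by simp
  moreover have "distinct (map fst (append_letter j z v))"
    unfolding fst_eq distinct_append distinct_map[of ?g] using dist inj by auto
  moreover have "\<forall>x\<in>set (append_letter j z v). snd x < r"
    using col \<open>z < r\<close> by (auto simp: append_letter_def)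
  ultimately show ?thesis by (simp add: colored_perms_def permutations_of_set_def)
qed

definition remove_last_letter :: "colored_word \<Rightarrow> colored_word" where
  "remove_last_letter w =
     map (\<lambda>(a, y). (if a < fst (last w) then a else a - 1, y)) (butlast w)"

lemma remove_last_append_letter: "remove_last_letter (append_letter j z v) = v"
  by (simp add: remove_last_letter_def append_letter_def case_prod_beta comp_def map_idI)

lemma remove_last_letter:
  assumes w: "w \<in> colored_perms r (Suc n)"
  shows "remove_last_letter w \<in> colored_perms r n"
    and "append_letter (fst (last w)) (snd (last w)) (remove_last_letter w) = w"
    and "fst (last w) \<in> {1..Suc n}" and "snd (last w) < r"
proof -
  obtain u j z where wu: "w = u @ [(j, z)]"
    using length_colored_perms[OF w] by (cases w rule: rev_cases) auto
  have "set (map fst w) = {1..Suc n}" and "distinct (map fst w)" and col: "\<forall>x\<in>set w. snd x < r"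
    using w by (auto simp: colored_perms_def permutations_of_set_def)
  then have set: "insert j (fst ` set u) = {1..Suc n}" and j: "j \<notin> fst ` set u"
    and dist: "distinct (map fst u)"
    by (simp_all add: wu)
  then have setu: "set (map fst u) = {1..Suc n} - {j}" by auto
  have jn: "j \<in> {1..Suc n}" using set by blast
  let ?g = "\<lambda>a. if a < j then a else a - 1"
  have fst_eq: "map fst (remove_last_letter w) = map ?g (map fst u)"
    by (simp add: remove_last_letter_def wu case_prod_beta comp_def)
  have "inj_on ?g ({1..Suc n} - {j})" by (auto simp: inj_on_def)
  then have "distinct (map fst (remove_last_letter w))"
    unfolding fst_eq distinct_map[of ?g] setu using dist by simp
  moreover have "?g ` ({1..Suc n} - {j}) = {1..n}"
  proof (intro equalityI subsetI)
    fix x assume x: "x \<in> {1..n}"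
    show "x \<in> ?g ` ({1..Suc n} - {j})"
    proof (cases "x < j")
      case True
      then show ?thesis using x by (intro image_eqI[of _ _ x]) auto
    next
      case False
      then show ?thesis using x by (intro image_eqI[of _ _ "Suc x"]) auto
    qed
  qed (use jn in \<open>auto split: if_splits\<close>)
  then have "set (map fst (remove_last_letter w)) = {1..n}"
    unfolding fst_eq set_map[of ?g] setu by simp
  moreover have "\<forall>x\<in>set (remove_last_letter w). snd x < r"
    using col by (auto simp: remove_last_letter_def wu)
  ultimately show "remove_last_letter w \<in> colored_perms r n"
    by (simp add: colored_perms_def permutations_of_set_def)
  have "(\<lambda>(a, y :: nat). (if a < j then a else Suc a, y)) (?g (fst x), snd x) = x" if "x \<in> set u" for x
  proof -
    have "fst x \<noteq> j" using j that by force
    then show ?thesis by (cases x) auto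
  qed
  then show "append_letter (fst (last w)) (snd (last w)) (remove_last_letter w) = w"
    by (auto simp: append_letter_def remove_last_letter_def wu case_prod_beta comp_def intro!: map_idI)
  show "fst (last w) \<in> {1..Suc n}" "snd (last w) < r" using jn col by (auto simp: wu)
qed

lemma sum_colored_perms_Suc:
  fixes g :: "colored_word \<Rightarrow> 'a::comm_monoid_add"
  shows "sum g (colored_perms r (Suc n))
    = (\<Sum>z<r. \<Sum>j\<in>{1..Suc n}. \<Sum>v\<in>colored_perms r n. g (append_letter j z v))"
proof -
  have "sum g (colored_perms r (Suc n))
      = (\<Sum>(z, j, v)\<in>{..<r} \<times> {1..Suc n} \<times> colored_perms r n. g (append_letter j z v))"
    by (rule sum.reindex_bij_witness[where j = "\<lambda>w. (snd (last w), fst (last w), remove_last_letter w)"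
          and i = "\<lambda>(z, j, v). append_letter j z v"])
       (use remove_last_letter in \<open>auto simp: remove_last_append_letter append_letter_colored_perms\<close>,
        auto simp: append_letter_def)
  also have "\<dots> = (\<Sum>z<r. \<Sum>j\<in>{1..Suc n}. \<Sum>v\<in>colored_perms r n. g (append_letter j z v))"
    by (simp add: sum.cartesian_product)
  finally show ?thesis .
qed

text \<open>
  The number \<open>z * n + (n - j)\<close> counts the letters above \<open>j\<close> of color \<open>z\<close>, so the \<open>r * n\<close> letters
  are enumerated from the top.
\<close>

lemma sum_letters_by_rank:
  fixes h :: "nat \<Rightarrow> 'a::comm_monoid_add"
  shows "(\<Sum>z<r. \<Sum>j\<in>{1..n}. h (z * n + (n - j))) = (\<Sum>e<r * n. h e)"
proof -
  have "(\<Sum>j\<in>{1..n}. h (z * n + (n - j))) = sum h {z * n..<z * n + n}" for z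
    by (rule sum.reindex_bij_witness[where j = "\<lambda>j. z * n + (n - j)" and i = "\<lambda>e. n - (e - z * n)"]) auto
  then show ?thesis by (simp add: sum.nat_group)
qed

lemma mult_bracket: "q * bracket m q = bracket m q - 1 + q ^ m"
  by (induction m) (simp_all add: bracket_def algebra_simps)

text \<open>
  The exponents \<open>0, \<dots>, t - 1\<close> are moved up by \<open>m\<close>, which turns the interval \<open>{0..<m}\<close> of exponents into
  \<open>{t..<t + m}\<close>.
\<close>

lemma sum_wrapped_powers:
  "t \<le> m \<Longrightarrow> (\<Sum>e<m. q ^ (e + (if e < t then m else 0))) = q ^ t * bracket m q"
proof (induction t)
  case 0
  show ?case by (simp add: bracket_def)
next
  case (Suc t)
  let ?f = "\<lambda>t e. q ^ (e + (if e < t then m else 0))"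
  have "(\<Sum>e<m. ?f (Suc t) e) = ?f (Suc t) t + (\<Sum>e\<in>{..<m} - {t}. ?f (Suc t) e)"
    using Suc.prems by (subst sum.remove[of _ t]) auto
  also have "(\<Sum>e\<in>{..<m} - {t}. ?f (Suc t) e) = (\<Sum>e\<in>{..<m} - {t}. ?f t e)"
    by (intro sum.cong) auto
  also have "\<dots> = (\<Sum>e<m. ?f t e) - ?f t t"
    using Suc.prems by (simp add: sum_diff1)
  also have "?f (Suc t) t + ((\<Sum>e<m. ?f t e) - ?f t t) = q ^ t * (bracket m q - 1 + q ^ m)"
    using Suc by (simp add: power_add algebra_simps)
  also have "\<dots> = q ^ Suc t * bracket m q"
    unfolding mult_bracket[symmetric] by (simp add: mult_ac)
  finally show ?case .
qed

text \<open>
  If the last letter is prescribed, the flag major index still has a product distribution, with an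
  offset equal to the number of letters above the prescribed one. In the inductive step the
  last but one letter runs over all letters; those above the new last letter create a descent,
  which adds \<open>r * (n + 1)\<close>, the number of letters it runs over. The exponents thus form
  a shifted interval.
\<close>

lemma sum_fmaj_append_letter:
  fixes q :: "'a::comm_ring_1"
  shows "j \<in> {1..Suc n} \<Longrightarrow> z < r \<Longrightarrow>
    (\<Sum>v\<in>colored_perms r n. q ^ fmaj r (append_letter j z v))
      = q ^ (z * Suc n + (Suc n - j)) * (\<Prod>k = 1..n. bracket (r * k) q)"
proof (induction n arbitrary: j z)
  case 0
  have "colored_perms r 0 = {[]}" by (auto simp: colored_perms_def)
  then show ?case using 0 by (simp add: append_letter_def fmaj_def maj_def)
next
  case (Suc n)
  let ?N = "Suc n"
  let ?P = "\<Prod>k = 1..n. bracket (r * k) q"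
  \<comment> \<open>The number of letters whose presence before the last letter creates a descent.\<close>
  define t where "t = z * ?N + (Suc ?N - j)"
  have t_le: "t \<le> Suc z * ?N"
  proof -
    have "Suc ?N - j \<le> ?N" using Suc.prems by auto
    then show ?thesis by (simp add: t_def)
  qed
  have t: "t \<le> r * ?N"
  proof -
    have "t \<le> Suc z * ?N" by (rule t_le)
    also have "\<dots> \<le> r * ?N" using Suc.prems by (intro mult_le_mono1) auto
    finally show ?thesis .
  qed
  have desc: "(y < z \<or> y = z \<and> j \<le> i) \<longleftrightarrow> y * ?N + (?N - i) < t" if "i \<in> {1..?N}" for i y
  proof (cases y z rule: linorder_cases)
    case less
    have "?N - i < ?N" using that by auto
    then have "y * ?N + (?N - i) < Suc y * ?N" by simp
    also have "\<dots> \<le> z * ?N" using less by (intro mult_le_mono1) auto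
    also have "\<dots> \<le> t" by (simp add: t_def)
    finally show ?thesis using less by simp
  next
    case equal
    then show ?thesis using that Suc.prems by (auto simp: t_def)
  next
    case greater
    have "t \<le> Suc z * ?N" by (rule t_le)
    also have "\<dots> \<le> y * ?N" using greater by (intro mult_le_mono1) auto
    finally show ?thesis using greater by simp
  qed
  have inner: "(\<Sum>u\<in>colored_perms r n. q ^ fmaj r (append_letter j z (append_letter i y u)))
      = q ^ z * ?P * (q ^ (y * ?N + (?N - i) + (if y * ?N + (?N - i) < t then r * ?N else 0)))"
    if i: "i \<in> {1..?N}" and y: "y < r" for i y
  proof -
    have "fmaj r (append_letter j z (append_letter i y u))
        = z + (if y * ?N + (?N - i) < t then r * ?N else 0) + fmaj r (append_letter i y u)"
      if u: "u \<in> colored_perms r n" for u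
    proof -
      have "append_letter i y u \<noteq> []" "last (append_letter i y u) = (i, y)"
        by (simp_all add: append_letter_def)
      then show ?thesis
        using fmaj_append_letter[OF append_letter_colored_perms[OF u i y], of j z] desc[OF i, of y]
        by simp
    qed
    then have "(\<Sum>u\<in>colored_perms r n. q ^ fmaj r (append_letter j z (append_letter i y u)))
        = q ^ (z + (if y * ?N + (?N - i) < t then r * ?N else 0))
          * (\<Sum>u\<in>colored_perms r n. q ^ fmaj r (append_letter i y u))"
      by (simp add: sum_distrib_left power_add)
    also have "\<dots> = q ^ (z + (if y * ?N + (?N - i) < t then r * ?N else 0))
          * (q ^ (y * ?N + (?N - i)) * ?P)"
      by (simp only: Suc.IH[OF i y])
    finally show ?thesis by (simp only: power_add mult_ac)
  qed
  have "(\<Sum>v\<in>colored_perms r ?N. q ^ fmaj r (append_letter j z v))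
      = (\<Sum>y<r. \<Sum>i\<in>{1..?N}. q ^ z * ?P *
           (q ^ (y * ?N + (?N - i) + (if y * ?N + (?N - i) < t then r * ?N else 0))))"
    unfolding sum_colored_perms_Suc using inner by (intro sum.cong refl) auto
  also have "\<dots> = q ^ z * ?P * (\<Sum>e<r * ?N. q ^ (e + (if e < t then r * ?N else 0)))"
    unfolding sum_distrib_left
    by (rule sum_letters_by_rank[where h = "\<lambda>e. q ^ z * ?P * q ^ (e + (if e < t then r * ?N else 0))"])
  also have "\<dots> = q ^ (z + t) * (?P * bracket (r * ?N) q)"
    unfolding sum_wrapped_powers[OF t] by (simp only: power_add mult_ac)
  also have "z + t = z * Suc ?N + (Suc ?N - j)" by (simp add: t_def)
  finally show ?case by simp
qed

text \<open>Summing the offsets of all possible last letters contributes one more factor.\<close>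

theorem sum_fmaj:
  fixes q :: "'a::comm_ring_1"
  shows "(\<Sum>w\<in>colored_perms r n. q ^ fmaj r w) = (\<Prod>k = 1..n. bracket (r * k) q)"
proof (cases n)
  case 0
  have "colored_perms r 0 = {[]}" by (auto simp: colored_perms_def)
  then show ?thesis using 0 by (simp add: fmaj_def maj_def)
next
  case (Suc m)
  let ?P = "\<Prod>k = 1..m. bracket (r * k) q"
  have "(\<Sum>w\<in>colored_perms r n. q ^ fmaj r w)
      = (\<Sum>z<r. \<Sum>j\<in>{1..Suc m}. q ^ (z * Suc m + (Suc m - j)) * ?P)"
    unfolding Suc sum_colored_perms_Suc
    by (intro sum.cong refl sum_fmaj_append_letter) auto
  also have "\<dots> = (\<Sum>e<r * Suc m. q ^ e * ?P)"
    by (rule sum_letters_by_rank[where h = "\<lambda>e. q ^ e * ?P"])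
  also have "\<dots> = bracket (r * Suc m) q * ?P"
    by (simp add: bracket_def sum_distrib_right)
  finally show ?thesis using Suc by (simp add: mult.commute)
qed

section \<open>Signs\<close>

lemma even_fmaf_iff_even_fmaj:
  assumes "w \<in> colored_perms r n" and "even r"
  shows "even (fmaf r w) \<longleftrightarrow> even (fmaj r w)"
  using assms by (simp add: fmaf_def fmaj_def sum_list_colors_delete_fixed)

lemma signed_power:
  fixes q :: "'a::comm_ring_1"
  assumes "even a \<longleftrightarrow> even b"
  shows "(- 1) ^ a * q ^ b = (- q) ^ b"
  using assms by (simp add: power_minus[of q b] minus_one_power_iff)

theorem theorem5p8:
  fixes r n :: nat and q :: "'a::comm_ring_1"
  assumes "r \<ge> 1" and "n \<ge> 1" and "even r"
  shows "(\<Sum>w\<in>colored_perms r n. (- 1) ^ fmaj r w * q ^ fmaf r w)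
           = (\<Sum>w\<in>colored_perms r n. (- 1) ^ fmaf r w * q ^ fmaj r w)
       \<and> (\<Sum>w\<in>colored_perms r n. (- 1) ^ fmaf r w * q ^ fmaj r w)
           = (\<Prod>k = 1..n. bracket (r * k) (- q))"
proof -
  have "(\<Sum>w\<in>colored_perms r n. (- 1) ^ fmaj r w * q ^ fmaf r w)
      = (\<Sum>w\<in>colored_perms r n. (- q) ^ fmaf r w)"
    using even_fmaf_iff_even_fmaj \<open>even r\<close> by (intro sum.cong refl signed_power) blast
  moreover have "(\<Sum>w\<in>colored_perms r n. (- 1) ^ fmaf r w * q ^ fmaj r w)
      = (\<Sum>w\<in>colored_perms r n. (- q) ^ fmaj r w)"
    using even_fmaf_iff_even_fmaj \<open>even r\<close> by (intro sum.cong refl signed_power) blast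
  ultimately show ?thesis
    using fmaf_fmaj_equidistributed[OF \<open>r \<ge> 1\<close>] sum_fmaj by metis
qed

end
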